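(* Let $(\mathfrak g,[-,-]_{\mathfrak g})$ and $(\mathfrak h,[-,-]_{\mathfrak h})$ be Lie algebras and let $\rho:\mathfrak g\to\mathrm{Der}(\mathfrak h)$ be a coherent action of $\mathfrak g$ on $\mathfrak h$. Then a linear map $T:\mathfrak h\to\mathfrak g$ is a nonabelian embedding tensor on $\mathfrak g$ with respect to $(\mathfrak h;\rho)$ if and only if its graph $G_T=\{Tu+u\mid u\in\mathfrak h\}$ is a Leibniz subalgebra of the Leibniz algebra $(\mathfrak g\oplus\mathfrak h,[-,-]_\rho)$, where $$[x+u,y+v]_\rho=[x,y]_{\mathfrak g}+\rho(x)v+[u,v]_{\mathfrak h},\qquad\forall x,y\in\mathfrak g,\ u,v\in\mathfrak h.$$
   Context: All vector spaces are over a fixed ground field. A Leibniz algebra is a vector space $\mathfrak G$ with a bilinear bracket satisfying $[x,[y,z]]=[[x,y],z]+[y,[x,z]]$ for all $x,y,z$; a Leibniz subalgebra is a linear subspace closed under the bracket. A coherent action of a Lie algebra $\mathfrak g$ on a Lie algebra $\mathfrak h$, denoted $(\mathfrak h;\rho)$, is a Lie algebra homomorphism $\rho:\mathfrak g\to\mathrm{Der}(\mathfrak h)$ such that $[\rho(x)u,v]_{\mathfrak h}=0$ for all $x\in\mathfrak g$, $u,v\in\mathfrak h$. For a coherent action, $(\mathfrak g\oplus\mathfrak h,[-,-]_\rho)$ is a Leibniz algebra (the nonabelian hemisemidirect product). A nonabelian embedding tensor on $\mathfrak g$ with respect to $(\mathfrak h;\rho)$ is a linear map $T:\mathfrak h\to\mathfrak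 g$ with $[Tu,Tv]_{\mathfrak g}=T\big(\rho(Tu)(v)+[u,v]_{\mathfrak h}\big)$ for all $u,v\in\mathfrak h$. *)

theory Defs
  imports "HOL-Analysis.Product_Vector"
begin

text \<open>
  A vector space over the field \<open>'k\<close> is a type together with a scalar multiplication
  satisfying the library locale \<^locale>\<open>vector_space\<close>. The name \<open>linear\<close> is qualified because
  \<open>Real_Vector_Spaces\<close> reuses it for real vector spaces.
\<close>

locale algebra_over_field = vector_space scale
  for scale :: "'k::field \<Rightarrow> 'a::ab_group_add \<Rightarrow> 'a" +
  fixes bracket :: "'a \<Rightarrow> 'a \<Rightarrow> 'a"
  assumes linear_right: "Vector_Spaces.linear scale scale (\<lambda>y. bracket x y)"
    and linear_left: "Vector_Spaces.linear scale scale (\<lambda>x. bracket x y)"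

locale leibniz_algebra = algebra_over_field +
  assumes leibniz: "bracket x (bracket y z) = bracket (bracket x y) z + bracket y (bracket x z)"

text \<open>
  The ground field is arbitrary, so the bracket is required to be alternating: in
  characteristic 2 this is stronger than skew-symmetry.
\<close>

locale lie_algebra = algebra_over_field +
  assumes alternating: "bracket x x = 0"
    and jacobi: "bracket x (bracket y z) + bracket y (bracket z x) + bracket z (bracket x y) = 0"

locale leibniz_subalgebra = leibniz_algebra scale bracket
  for scale :: "'k::field \<Rightarrow> 'a::ab_group_add \<Rightarrow> 'a" and bracket :: "'a \<Rightarrow> 'a \<Rightarrow> 'a" +
  fixes S :: "'a set"
  assumes is_subspace: "subspace S"
    and bracket_closed: "x \<in> S \<Longrightarrow> y \<in> S \<Longrightarrow> bracket x y \<in> S"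

definition Der :: "('k::field \<Rightarrow> 'a::ab_group_add \<Rightarrow> 'a) \<Rightarrow> ('a \<Rightarrow> 'a \<Rightarrow> 'a) \<Rightarrow> ('a \<Rightarrow> 'a) set" where
  "Der s bracket = {D. Vector_Spaces.linear s s D \<and>
     (\<forall>u v. D (bracket u v) = bracket (D u) v + bracket u (D v))}"

text \<open>
  The first four assumptions on \<open>\<rho>\<close> say that it is a Lie algebra homomorphism into \<^const>\<open>Der\<close>,
  whose vector space operations are pointwise and whose bracket is the commutator.
\<close>

locale coherent_action =
  g: lie_algebra scale_g bracket_g + h: lie_algebra scale_h bracket_h
  for scale_g :: "'k::field \<Rightarrow> 'g::ab_group_add \<Rightarrow> 'g" and bracket_g :: "'g \<Rightarrow> 'g \<Rightarrow> 'g"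
    and scale_h :: "'k \<Rightarrow> 'h::ab_group_add \<Rightarrow> 'h" and bracket_h :: "'h \<Rightarrow> 'h \<Rightarrow> 'h" +
  fixes \<rho> :: "'g \<Rightarrow> 'h \<Rightarrow> 'h"
  assumes rho_Der: "\<rho> x \<in> Der scale_h bracket_h"
    and rho_add: "\<rho> (x + y) = (\<lambda>u. \<rho> x u + \<rho> y u)"
    and rho_scale: "\<rho> (scale_g c x) = (\<lambda>u. scale_h c (\<rho> x u))"
    and rho_bracket: "\<rho> (bracket_g x y) = (\<lambda>u. \<rho> x (\<rho> y u) - \<rho> y (\<rho> x u))"
    and coherent: "bracket_h (\<rho> x u) v = 0"

locale nonabelian_embedding_tensor =
  coherent_action scale_g bracket_g scale_h bracket_h \<rho> +
  T: Vector_Spaces.linear scale_h scale_g T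
  for scale_g :: "'k::field \<Rightarrow> 'g::ab_group_add \<Rightarrow> 'g" and bracket_g :: "'g \<Rightarrow> 'g \<Rightarrow> 'g"
    and scale_h :: "'k \<Rightarrow> 'h::ab_group_add \<Rightarrow> 'h" and bracket_h :: "'h \<Rightarrow> 'h \<Rightarrow> 'h"
    and \<rho> :: "'g \<Rightarrow> 'h \<Rightarrow> 'h" and T :: "'h \<Rightarrow> 'g" +
  assumes embedding: "bracket_g (T u) (T v) = T (\<rho> (T u) v + bracket_h u v)"

text \<open>
  The direct sum \<open>\<gg> \<oplus> \<hh>\<close> is the product type with the scalar multiplication
  \<^const>\<open>module_prod.scale\<close>; \<open>x + u\<close> is the pair \<open>(x, u)\<close>.
\<close>

definition hemisemidirect_bracket ::
  "('g \<Rightarrow> 'g \<Rightarrow> 'g) \<Rightarrow> ('h \<Rightarrow> 'h \<Rightarrow> 'h::plus) \<Rightarrow> ('g \<Rightarrow> 'h \<Rightarrow> 'h) \<Rightarrow> 'g \<times> 'h \<Rightarrow> 'g \<times> 'h \<Rightarrow> 'g \<times> 'h"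
  where "hemisemidirect_bracket bracket_g bracket_h \<rho> =
    (\<lambda>(x, u) (y, v). (bracket_g x y, \<rho> x v + bracket_h u v))"

definition graph_of :: "('h \<Rightarrow> 'g) \<Rightarrow> ('g \<times> 'h) set" where
  "graph_of T = {(T u, u) | u. True}"

end

theory Submission
  imports Defs
begin

text \<open>
  The product of two elements of the graph is
  \<open>[Tu + u, Tv + v] = [Tu, Tv] + (\<rho>(Tu)v + [u, v])\<close>, whose component in \<open>\<hh>\<close> is
  \<open>w = \<rho>(Tu)v + [u, v]\<close>. It lies in the graph exactly when its component in \<open>\<gg>\<close> is \<open>Tw\<close>,
  which is the defining identity of an embedding tensor. Linearity of \<open>T\<close> makes the graph a
  subspace, so the equivalence is this comparison of components.

  The notion of Leibniz subalgebra also contains the fact that the ambient bracket on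
  \<open>\<gg> \<oplus> \<hh>\<close> satisfies the Leibniz identity. That is where coherence enters: it makes all brackets
  of \<open>\<hh>\<close> with an entry of the form \<open>\<rho>(x)u\<close> vanish and, since \<open>\<rho>(x)\<close> is a derivation, also
  \<open>\<rho>(x)[u, v] = 0\<close>. The Leibniz identity then splits into the one of \<open>\<gg>\<close>, the one of \<open>\<hh>\<close>, and
  the compatibility of \<open>\<rho>\<close> with brackets.
\<close>

context algebra_over_field
begin

lemma bracket_add_left: "bracket (x + y) z = bracket x z + bracket y z"
  using linear_left by (simp add: Vector_Spaces.linear_iff)

lemma bracket_add_right: "bracket x (y + z) = bracket x y + bracket x z"
  using linear_right by (simp add: Vector_Spaces.linear_iff)

lemma bracket_scale_left: "bracket (scale c x) y = scale c (bracket x y)"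
  using linear_left by (simp add: Vector_Spaces.linear_iff)

lemma bracket_scale_right: "bracket x (scale c y) = scale c (bracket x y)"
  using linear_right by (simp add: Vector_Spaces.linear_iff)

lemma bracket_minus_right: "bracket x (- y) = - bracket x y"
proof -
  interpret Vector_Spaces.linear scale scale "bracket x" by (rule linear_right)
  show ?thesis by (rule neg)
qed

end

context lie_algebra
begin

lemma skew_symmetric: "bracket x y = - bracket y x"
proof -
  have "bracket (x + y) (x + y) = bracket x x + bracket x y + (bracket y x + bracket y y)"
    by (simp only: bracket_add_left bracket_add_right ac_simps)
  then have "bracket x y + bracket y x = 0"
    by (simp add: alternating)
  then show ?thesis
    by (simp add: eq_neg_iff_add_eq_0)
qed

text \<open>
  Skew-symmetry turns the cyclic form of the Jacobi identity into the statement that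
  left multiplications are derivations.
\<close>

lemma leibniz_identity:
  "bracket x (bracket y z) = bracket (bracket x y) z + bracket y (bracket x z)"
proof -
  have "bracket y (bracket z x) = - bracket y (bracket x z)"
    by (metis skew_symmetric bracket_minus_right)
  moreover have "bracket z (bracket x y) = - bracket (bracket x y) z"
    by (rule skew_symmetric)
  ultimately show ?thesis
    using jacobi[of x y z] by (simp add: algebra_simps)
qed

end

context coherent_action
begin

lemma rho_add_right: "\<rho> x (u + v) = \<rho> x u + \<rho> x v"
  and rho_scale_right: "\<rho> x (scale_h c u) = scale_h c (\<rho> x u)"
proof -
  interpret Vector_Spaces.linear scale_h scale_h "\<rho> x"
    using rho_Der[of x] by (simp add: Der_def)
  show "\<rho> x (u + v) = \<rho> x u + \<rho> x v" by (rule add)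
  show "\<rho> x (scale_h c u) = scale_h c (\<rho> x u)" by (rule scale)
qed

lemma coherent_right: "bracket_h v (\<rho> x u) = 0"
  using h.skew_symmetric[of v "\<rho> x u"] by (simp add: coherent)

text \<open>By the derivation rule \<open>\<rho>(x)[u, v]\<close> is a sum of two terms that coherence kills.\<close>

lemma rho_bracket_h: "\<rho> x (bracket_h u v) = 0"
  using rho_Der[of x] by (simp add: Der_def coherent coherent_right)

text \<open>
  Once coherence has removed the mixed terms, the three products in the Leibniz identity for
  \<open>x + u\<close>, \<open>y + v\<close>, \<open>z + w\<close> have the \<open>\<hh>\<close>-components \<open>\<rho>(x)\<rho>(y)w + [u, [v, w]]\<close>,
  \<open>\<rho>([x, y])w + [[u, v], w]\<close> and \<open>\<rho>(y)\<rho>(x)w + [v, [u, w]]\<close>, and \<open>\<rho>([x, y])\<close> is the commutator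
  of \<open>\<rho>(x)\<close> and \<open>\<rho>(y)\<close>.
\<close>

lemma leibniz_algebra_hemisemidirect:
  "leibniz_algebra (module_prod.scale scale_g scale_h)
     (hemisemidirect_bracket bracket_g bracket_h \<rho>)"
proof -
  interpret vector_space_prod scale_g scale_h ..
  let ?B = "hemisemidirect_bracket bracket_g bracket_h \<rho>"
  note simps = hemisemidirect_bracket_def scale_prod split_beta rho_add rho_scale
    rho_add_right rho_scale_right
    g.bracket_add_left g.bracket_add_right g.bracket_scale_left g.bracket_scale_right
    h.bracket_add_left h.bracket_add_right h.bracket_scale_left h.bracket_scale_right
  show ?thesis
  proof
    show "?B x (y + z) = ?B x y + ?B x z" for x y z
      by (simp add: simps prod_eq_iff algebra_simps)
    show "?B (y + z) x = ?B y x + ?B z x" for x y z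
      by (simp add: simps prod_eq_iff algebra_simps)
    show "?B x (scale c y) = scale c (?B x y)" for x y c
      by (cases x; cases y) (simp add: simps h.vector_space_assms)
    show "?B (scale c x) y = scale c (?B x y)" for x y c
      by (cases x; cases y) (simp add: simps h.vector_space_assms)
    show "?B x (?B y z) = ?B (?B x y) z + ?B y (?B x z)" for x y z
    proof (cases x; cases y; cases z)
      fix x' u y' v z' w
      assume "x = (x', u)" "y = (y', v)" "z = (z', w)"
      then show ?thesis
        by (simp add: simps coherent coherent_right rho_bracket_h rho_bracket
            g.leibniz_identity[of x' y' z'] h.leibniz_identity[of u v w])
    qed
  qed
qed

end

lemma (in vector_space_prod) subspace_graph_of:
  assumes "Vector_Spaces.linear s2 s1 T"
  shows "p.subspace (graph_of T)"
proof -
  interpret T: Vector_Spaces.linear s2 s1 T by fact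
  show ?thesis
    by (auto simp: p.subspace_def graph_of_def scale_prod zero_prod_def T.zero T.add T.scale)
qed

lemma hemisemidirect_bracket_in_graph_iff:
  "hemisemidirect_bracket bracket_g bracket_h \<rho> (T u, u) (T v, v) \<in> graph_of T \<longleftrightarrow>
     bracket_g (T u) (T v) = T (\<rho> (T u) v + bracket_h u v)"
  by (auto simp: hemisemidirect_bracket_def graph_of_def)

theorem proposition2p10:
  fixes scale_g :: "'k::field \<Rightarrow> 'g::ab_group_add \<Rightarrow> 'g" and bracket_g :: "'g \<Rightarrow> 'g \<Rightarrow> 'g"
    and scale_h :: "'k \<Rightarrow> 'h::ab_group_add \<Rightarrow> 'h" and bracket_h :: "'h \<Rightarrow> 'h \<Rightarrow> 'h"
    and \<rho> :: "'g \<Rightarrow> 'h \<Rightarrow> 'h" and T :: "'h \<Rightarrow> 'g"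
  assumes "lie_algebra scale_g bracket_g" and "lie_algebra scale_h bracket_h"
    and "coherent_action scale_g bracket_g scale_h bracket_h \<rho>"
    and "Vector_Spaces.linear scale_h scale_g T"
  shows "nonabelian_embedding_tensor scale_g bracket_g scale_h bracket_h \<rho> T \<longleftrightarrow>
    leibniz_subalgebra (module_prod.scale scale_g scale_h)
      (hemisemidirect_bracket bracket_g bracket_h \<rho>) (graph_of T)"
proof -
  interpret coherent_action scale_g bracket_g scale_h bracket_h \<rho> by fact
  interpret P: vector_space_prod scale_g scale_h ..
  let ?B = "hemisemidirect_bracket bracket_g bracket_h \<rho>"
  have "nonabelian_embedding_tensor scale_g bracket_g scale_h bracket_h \<rho> T \<longleftrightarrow>
      (\<forall>u v. ?B (T u, u) (T v, v) \<in> graph_of T)"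
    using assms(3,4)
    by (simp add: nonabelian_embedding_tensor_def nonabelian_embedding_tensor_axioms_def
        hemisemidirect_bracket_in_graph_iff)
  also have "\<dots> \<longleftrightarrow> (\<forall>x\<in>graph_of T. \<forall>y\<in>graph_of T. ?B x y \<in> graph_of T)"
    by (auto simp: graph_of_def)
  also have "\<dots> \<longleftrightarrow> leibniz_subalgebra P.scale ?B (graph_of T)"
    using leibniz_algebra_hemisemidirect P.subspace_graph_of[OF assms(4)]
    by (auto simp: leibniz_subalgebra_def leibniz_subalgebra_axioms_def)
  finally show ?thesis .
qed

end
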